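(* Let $\mathcal{C} \subset \mathbb{R}^n$ be a nonempty compact, convex set, and let $\mathbf{c}$ be the center and $r$ the radius of the smallest sphere containing $\mathcal{C}$. Let $$\mathcal{S}_1 = \{ \ell: \mathbb{R}^n \rightarrow \mathbb{R} \mbox{ such that } \ell \mbox{ is affine and } -\|\mathbf{x}\|^2 \ge \ell(\mathbf{x}) \mbox{ for all } \mathbf{x} \in \mathcal{C} \}.$$ Then the smallest sphere containing $\mathcal{C}$ is unique, and a solution of the problem $$\min_{\ell \in \mathcal{S}_1} \; \max_{\mathbf{x}\in \mathcal{C}} \; -\left( \|\mathbf{x}\|^2 + \ell(\mathbf{x}) \right)$$ is $$\ell^*(\mathbf{x}) = -2\mathbf{c}^{\sf T}\mathbf{x} + \|\mathbf{c}\|^2 - r^2 .$$ Furthermore, $$\min_{\ell \in \mathcal{S}_1} \; \max_{\mathbf{x}\in \mathcal{C}} \; -\left( \|\mathbf{x}\|^2 + \ell(\mathbf{x}) \right) = r^2 .$$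
   Context: $\|\cdot\|$ denotes the Euclidean norm. A sphere with center $\mathbf{c}$ and radius $r \ge 0$ is said to contain $\mathcal{C}$ if $\|\mathbf{x}-\mathbf{c}\| \le r$ for all $\mathbf{x}\in\mathcal{C}$ (i.e. $\mathcal{C}$ lies in the closed ball); a smallest sphere containing $\mathcal{C}$ is one of minimal radius. That $\ell^*$ is a solution of the min-max problem means that $\ell^*\in\mathcal{S}_1$ and that $\ell^*$ attains the minimum over $\mathcal{S}_1$. *)

theory Defs
  imports "HOL-Analysis.Analysis"
begin

definition affine_fun :: "(real ^ 'n \<Rightarrow> real) \<Rightarrow> bool" where
  "affine_fun l \<longleftrightarrow> (\<exists>h b. linear h \<and> l = (\<lambda>x. h x + b))"

definition sphere_contains :: "real ^ 'n \<Rightarrow> real \<Rightarrow> (real ^ 'n) set \<Rightarrow> bool" where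
  "sphere_contains c r C \<longleftrightarrow> 0 \<le> r \<and> (\<forall>x\<in>C. norm (x - c) \<le> r)"

definition smallest_sphere :: "(real ^ 'n) set \<Rightarrow> real ^ 'n \<Rightarrow> real \<Rightarrow> bool" where
  "smallest_sphere C c r \<longleftrightarrow>
     sphere_contains c r C \<and> (\<forall>c' r'. sphere_contains c' r' C \<longrightarrow> r \<le> r')"

definition S1 :: "(real ^ 'n) set \<Rightarrow> (real ^ 'n \<Rightarrow> real) set" where
  "S1 C = {l. affine_fun l \<and> (\<forall>x\<in>C. - (norm x)\<^sup>2 \<ge> l x)}"

text \<open>
  \<open>max_on\<close> and \<open>min_on\<close> are maxima and minima in the strict sense: the greatest and least
  \<^emph>\<open>attained\<close> value. They are unspecified when no such value exists; \<open>max_on_gap\<close> below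
  shows that the inner maximum of the problem does exist.
\<close>

definition max_on :: "'a set \<Rightarrow> ('a \<Rightarrow> real) \<Rightarrow> real" where
  "max_on A f = (GREATEST v. v \<in> f ` A)"

definition min_on :: "'a set \<Rightarrow> ('a \<Rightarrow> real) \<Rightarrow> real" where
  "min_on A f = (LEAST v. v \<in> f ` A)"

definition max_gap :: "(real ^ 'n) set \<Rightarrow> (real ^ 'n \<Rightarrow> real) \<Rightarrow> real" where
  "max_gap C l = max_on C (\<lambda>x. - ((norm x)\<^sup>2 + l x))"

lemma max_on_eqI:
  assumes "x \<in> A" "\<And>y. y \<in> A \<Longrightarrow> f y \<le> f x"
  shows "max_on A f = f x"
  unfolding max_on_def using assms by (intro Greatest_equality) auto

lemma max_on_gap:
  fixes C :: "(real ^ 'n) set"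
  assumes "C \<noteq> {}" "compact C" "affine_fun l"
  shows "\<exists>x\<in>C. max_gap C l = - ((norm x)\<^sup>2 + l x) \<and>
           (\<forall>y\<in>C. - ((norm y)\<^sup>2 + l y) \<le> - ((norm x)\<^sup>2 + l x))"
proof -
  obtain h b where h: "linear h" and l: "l = (\<lambda>x. h x + b)"
    using assms(3) unfolding affine_fun_def by blast
  have "continuous_on C (\<lambda>x. - ((norm x)\<^sup>2 + l x))"
    unfolding l by (intro continuous_intros linear_continuous_on linear_linear[THEN iffD2] h)
  then obtain x where "x \<in> C"
    and "\<forall>y\<in>C. - ((norm y)\<^sup>2 + l y) \<le> - ((norm x)\<^sup>2 + l x)"
    using continuous_attains_sup[OF assms(2,1)] by blast
  then show ?thesis
    unfolding max_gap_def using max_on_eqI[of x C "\<lambda>x. - ((norm x)\<^sup>2 + l x)"] by blast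
qed

end

theory Submission imports Defs
begin

text \<open>
  Completing the square, every affine \<open>l\<close> satisfies
  \<open>- (\<parallel>x\<parallel>\<^sup>2 + l x) = s - \<parallel>x - a\<parallel>\<^sup>2\<close> for some \<open>a\<close> and \<open>s\<close>, and \<open>l\<close> is feasible iff \<open>C\<close>
  lies in the ball about \<open>a\<close> of squared radius \<open>s\<close>. Its objective value is \<open>s - d\<^sup>2\<close> with
  \<open>d\<close> the distance from \<open>a\<close> to \<open>C\<close>. If \<open>p\<close> is the projection of \<open>a\<close> onto \<open>C\<close>, then
  \<open>\<parallel>x - p\<parallel>\<^sup>2 \<le> \<parallel>x - a\<parallel>\<^sup>2 - d\<^sup>2 \<le> s - d\<^sup>2\<close> on \<open>C\<close>, so \<open>r\<^sup>2 \<le> s - d\<^sup>2\<close> by minimality of \<open>r\<close>.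
  The same projection argument puts the optimal centre \<open>c\<close> into \<open>C\<close>, so \<open>l\<^sup>*\<close>, which has
  \<open>a = c\<close> and \<open>s = r\<^sup>2\<close>, attains the bound. Uniqueness of \<open>c\<close> is the parallelogram law.
\<close>

text \<open>At the projection the angle between \<open>a\<close> and any point of \<open>C\<close>
  is not acute, so the cross term in the law of cosines has the favourable sign.\<close>

lemma norm_diff_closest_point_le:
  fixes C :: "'a::euclidean_space set"
  assumes "convex C" "closed C" "x \<in> C"
  shows "(norm (x - closest_point C a))\<^sup>2
    \<le> (norm (x - a))\<^sup>2 - (norm (closest_point C a - a))\<^sup>2"
proof -
  let ?p = "closest_point C a"
  have "(a - ?p) \<bullet> (x - ?p) \<le> 0"
    using closest_point_dot[OF assms] .
  moreover have "(norm (x - a))\<^sup>2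
      = (norm (x - ?p))\<^sup>2 + (norm (?p - a))\<^sup>2 - 2 * ((a - ?p) \<bullet> (x - ?p))"
    unfolding power2_norm_eq_inner by (simp add: inner_diff inner_commute)
  ultimately show ?thesis by linarith
qed

text \<open>Minimality in squared form, so that later bounds need no roots. A point of
  \<open>C\<close> forces \<open>0 \<le> s\<close>, which makes \<open>sqrt s\<close> a legitimate
  radius.\<close>

lemma smallest_sphere_square_le:
  assumes "smallest_sphere C c r" "C \<noteq> {}"
    and "\<And>x. x \<in> C \<Longrightarrow> (norm (x - a))\<^sup>2 \<le> s"
  shows "r\<^sup>2 \<le> s"
proof -
  obtain x where "x \<in> C" using assms(2) by blast
  then have s: "0 \<le> s" using assms(3)[of x] by (meson order_trans zero_le_power2)
  have "sphere_contains a (sqrt s) C"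
    using s assms(3) by (auto simp: sphere_contains_def intro: real_le_rsqrt)
  then have "0 \<le> r" "r \<le> sqrt s"
    using assms(1) by (auto simp: smallest_sphere_def sphere_contains_def)
  then show ?thesis
    using s power_mono[of r "sqrt s" 2] by simp
qed

lemma sphere_contains_square:
  assumes "sphere_contains c r C" "x \<in> C"
  shows "(norm (x - c))\<^sup>2 \<le> r\<^sup>2"
  using assms by (auto simp: sphere_contains_def intro: power_mono)

lemma smallest_sphere_center_in:
  assumes "smallest_sphere C c r" "C \<noteq> {}" "compact C" "convex C"
  shows "c \<in> C"
proof -
  let ?p = "closest_point C c"
  have cl: "closed C" using assms(3) by (rule compact_imp_closed)
  have "(norm (x - ?p))\<^sup>2 \<le> r\<^sup>2 - (norm (?p - c))\<^sup>2" if "x \<in> C" for x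
    using norm_diff_closest_point_le[OF assms(4) cl that, of c]
      sphere_contains_square[OF _ that, of c r] assms(1)
    by (auto simp: smallest_sphere_def)
  \<comment> \<open>Recentring at \<open>?p\<close> would shrink the sphere unless \<open>?p\<close>
    and \<open>c\<close> coincide.\<close>
  then have "r\<^sup>2 \<le> r\<^sup>2 - (norm (?p - c))\<^sup>2"
    by (rule smallest_sphere_square_le[OF assms(1,2)])
  then have "?p = c" by simp
  then show ?thesis
    using closest_point_in_set[OF cl assms(2), of c] by simp
qed

lemma smallest_sphere_exists:
  fixes C :: "(real ^ 'n) set"
  assumes "C \<noteq> {}" "compact C" "convex C"
  shows "\<exists>c r. smallest_sphere C c r"
proof -
  have cl: "closed C" using assms(2) by (rule compact_imp_closed)
  \<comment> \<open>Pairs of centre and radius, confined to a compact set so that the radius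
    \<open>snd\<close> attains its infimum.\<close>
  define K where "K = (C \<times> {0..diameter C}) \<inter> (\<Inter>x\<in>C. {q. norm (x - fst q) \<le> snd q})"
  have "compact K"
    unfolding K_def
    by (intro compact_Int_closed compact_Times assms compact_Icc closed_INT ballI
        closed_Collect_le continuous_intros)
  moreover obtain y where y: "y \<in> C" using assms(1) by blast
  have "(y, diameter C) \<in> K"
    using y diameter_bounded_bound[OF compact_imp_bounded[OF assms(2)]]
      diameter_ge_0[OF compact_imp_bounded[OF assms(2)]]
    by (auto simp: K_def dist_norm)
  ultimately obtain q where q: "q \<in> K" and q_min: "\<And>q'. q' \<in> K \<Longrightarrow> snd q \<le> snd q'"
    using continuous_attains_inf[of K snd] continuous_on_snd[OF continuous_on_id] by fastforce
  \<comment> \<open>The confinement loses nothing: projecting a centre onto \<open>C\<close> keeps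
    the radius valid, and radii above the diameter already exceed \<open>snd q\<close>.\<close>
  have "snd q \<le> r" if sc: "sphere_contains c r C" for c r
  proof (cases "r \<le> diameter C")
    case True
    let ?p = "closest_point C c"
    have "norm (x - ?p) \<le> r" if "x \<in> C" for x
    proof (rule power2_le_imp_le)
      show "(norm (x - ?p))\<^sup>2 \<le> r\<^sup>2"
        using norm_diff_closest_point_le[OF assms(3) cl that, of c]
          sphere_contains_square[OF sc that] zero_le_power2[of "norm (?p - c)"] by linarith
      show "0 \<le> r" using sc by (simp add: sphere_contains_def)
    qed
    then have "(?p, r) \<in> K"
      using True sc closest_point_in_set[OF cl assms(1)]
      by (auto simp: K_def sphere_contains_def)
    then show ?thesis using q_min by fastforce
  next
    case False
    then show ?thesis using q by (auto simp: K_def)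
  qed
  moreover have "sphere_contains (fst q) (snd q) C"
    using q by (auto simp: K_def sphere_contains_def)
  ultimately have "smallest_sphere C (fst q) (snd q)"
    by (auto simp: smallest_sphere_def)
  then show ?thesis by blast
qed

lemma smallest_sphere_unique:
  assumes "smallest_sphere C c r" "smallest_sphere C c' r'" "C \<noteq> {}"
  shows "c = c' \<and> r = r'"
proof -
  have r: "r = r'" using assms(1,2) by (auto simp: smallest_sphere_def intro: antisym)
  \<comment> \<open>Distinct centres would make the midpoint the centre of a strictly smaller
    sphere.\<close>
  let ?m = "(1/2) *\<^sub>R (c + c')"
  have "(norm (x - ?m))\<^sup>2 \<le> r\<^sup>2 - (norm (c - c'))\<^sup>2 / 4" if "x \<in> C" for x
  proof -
    have le: "(norm (x - c))\<^sup>2 \<le> r\<^sup>2" "(norm (x - c'))\<^sup>2 \<le> r\<^sup>2"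
      using assms(1,2) that r sphere_contains_square by (auto simp: smallest_sphere_def)
    have mid: "(norm (x - ?m))\<^sup>2
        = ((norm (x - c))\<^sup>2 + (norm (x - c'))\<^sup>2) / 2 - (norm (c - c'))\<^sup>2 / 4"
      unfolding power2_norm_eq_inner by (simp add: algebra_simps inner_commute field_simps)
    show ?thesis unfolding mid using le by (simp add: field_simps)
  qed
  then have "r\<^sup>2 \<le> r\<^sup>2 - (norm (c - c'))\<^sup>2 / 4"
    by (rule smallest_sphere_square_le[OF assms(1,3)])
  then show ?thesis using r by simp
qed

lemma affine_fun_complete_square:
  assumes "affine_fun l"
  obtains a s where "\<And>x. (norm x)\<^sup>2 + l x = (norm (x - a))\<^sup>2 - s"
proof -
  obtain h b where h: "linear h" and l: "l = (\<lambda>x. h x + b)"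
    using assms unfolding affine_fun_def by blast
  \<comment> \<open>\<open>adjoint h 1\<close> is the Riesz vector of the functional
    \<open>h\<close>; the factor comes from matching \<open>- 2 * (x \<bullet> a)\<close> with
    \<open>h x\<close>.\<close>
  let ?a = "- (1/2) *\<^sub>R adjoint h 1"
  have "(norm x)\<^sup>2 + l x = (norm (x - ?a))\<^sup>2 - ((norm ?a)\<^sup>2 - b)" for x
  proof -
    have "h x = x \<bullet> adjoint h 1" using adjoint_works[OF h, of x 1] by simp
    then show ?thesis
      unfolding l power2_norm_eq_inner by (simp add: inner_diff inner_add inner_commute)
  qed
  then show ?thesis by (rule that)
qed

lemma max_gap_ge:
  assumes "C \<noteq> {}" "compact C" "l \<in> S1 C" "y \<in> C"
  shows "- ((norm y)\<^sup>2 + l y) \<le> max_gap C l"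
  using max_on_gap[of C l] assms by (auto simp: S1_def)

lemma smallest_sphere_le_max_gap:
  assumes "smallest_sphere C c r" "C \<noteq> {}" "compact C" "convex C" "l \<in> S1 C"
  shows "r\<^sup>2 \<le> max_gap C l"
proof -
  have cl: "closed C" using assms(3) by (rule compact_imp_closed)
  obtain a s where l: "\<And>x. (norm x)\<^sup>2 + l x = (norm (x - a))\<^sup>2 - s"
    using affine_fun_complete_square assms(5) unfolding S1_def by blast
  let ?p = "closest_point C a"
  have "(norm (x - ?p))\<^sup>2 \<le> s - (norm (?p - a))\<^sup>2" if "x \<in> C" for x
  proof -
    have "(norm x)\<^sup>2 + l x \<le> 0" using assms(5) that by (force simp: S1_def)
    then show ?thesis
      using norm_diff_closest_point_le[OF assms(4) cl that, of a] l[of x] by linarith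
  qed
  then have "r\<^sup>2 \<le> s - (norm (?p - a))\<^sup>2"
    by (rule smallest_sphere_square_le[OF assms(1,2)])
  \<comment> \<open>The middle term is the objective evaluated at the feasible point
    \<open>?p\<close>.\<close>
  also have "\<dots> \<le> max_gap C l"
    using max_gap_ge[OF assms(2,3,5) closest_point_in_set[OF cl assms(2)], of a] l[of ?p]
    by linarith
  finally show ?thesis .
qed

lemma norm_power2_add_optimal:
  "(norm x)\<^sup>2 + (- 2 * (c \<bullet> x) + (norm c)\<^sup>2 - t) = (norm (x - c))\<^sup>2 - t"
  unfolding power2_norm_eq_inner by (simp add: inner_diff inner_commute)

lemma optimal_in_S1:
  assumes "sphere_contains c r C"
  shows "(\<lambda>x. - 2 * (c \<bullet> x) + (norm c)\<^sup>2 - r\<^sup>2) \<in> S1 C"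
proof -
  have "linear (\<lambda>x. - 2 * (c \<bullet> x))"
    by (rule linearI) (simp_all add: inner_add_right algebra_simps)
  moreover have "(\<lambda>x. - 2 * (c \<bullet> x) + (norm c)\<^sup>2 - r\<^sup>2)
      = (\<lambda>x. - 2 * (c \<bullet> x) + ((norm c)\<^sup>2 - r\<^sup>2))"
    by (simp add: algebra_simps)
  ultimately have "affine_fun (\<lambda>x. - 2 * (c \<bullet> x) + (norm c)\<^sup>2 - r\<^sup>2)"
    unfolding affine_fun_def by blast
  moreover have "- 2 * (c \<bullet> x) + (norm c)\<^sup>2 - r\<^sup>2 \<le> - (norm x)\<^sup>2" if "x \<in> C" for x
    using sphere_contains_square[OF assms that] norm_power2_add_optimal[of x c "r\<^sup>2"]
    by linarith
  ultimately show ?thesis by (simp add: S1_def)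
qed

text \<open>The gap is \<open>r\<^sup>2 - (norm (x - c))\<^sup>2\<close>, largest at
  \<open>x = c\<close>, which is available because the centre lies in \<open>C\<close>.\<close>

lemma max_gap_optimal:
  assumes "smallest_sphere C c r" "C \<noteq> {}" "compact C" "convex C"
  shows "max_gap C (\<lambda>x. - 2 * (c \<bullet> x) + (norm c)\<^sup>2 - r\<^sup>2) = r\<^sup>2"
  unfolding max_gap_def norm_power2_add_optimal
  using max_on_eqI[OF smallest_sphere_center_in[OF assms],
      of "\<lambda>x. - ((norm (x - c))\<^sup>2 - r\<^sup>2)"]
  by simp

theorem theorem3p1:
  fixes C :: "(real ^ 'n) set"
  assumes "C \<noteq> {}" and "compact C" and "convex C"
  shows "(\<exists>!(c, r). smallest_sphere C c r) \<and>
    (\<forall>c r. smallest_sphere C c r \<longrightarrow>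
       is_arg_min (max_gap C) (\<lambda>l. l \<in> S1 C)
         (\<lambda>x. - 2 * (c \<bullet> x) + (norm c)\<^sup>2 - r\<^sup>2) \<and>
       min_on (S1 C) (max_gap C) = r\<^sup>2)"
proof (intro conjI allI impI)
  show "\<exists>!(c, r). smallest_sphere C c r"
    using smallest_sphere_exists[OF assms] smallest_sphere_unique[OF _ _ assms(1)]
    by fast
next
  fix c r assume ss: "smallest_sphere C c r"
  let ?l = "\<lambda>x. - 2 * (c \<bullet> x) + (norm c)\<^sup>2 - r\<^sup>2"
  have mem: "?l \<in> S1 C"
    using ss by (intro optimal_in_S1) (simp add: smallest_sphere_def)
  have val: "max_gap C ?l = r\<^sup>2" by (rule max_gap_optimal[OF ss assms])
  have lower: "r\<^sup>2 \<le> max_gap C l" if "l \<in> S1 C" for l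
    by (rule smallest_sphere_le_max_gap[OF ss assms that])
  show "is_arg_min (max_gap C) (\<lambda>l. l \<in> S1 C) ?l"
    unfolding is_arg_min_linorder val using mem lower by blast
  show "min_on (S1 C) (max_gap C) = r\<^sup>2"
    unfolding min_on_def
  proof (rule Least_equality)
    show "r\<^sup>2 \<in> max_gap C ` S1 C" using mem val by (metis imageI)
  qed (use lower in blast)
qed

end
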